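(* Let $n\ge 2$ and let $\ell\ge 1$ be an integer. If the family $d=\{d^{i,j}\}_{i,j}$ is a metric, then the pairwise MMOT distance $\mathcal{W}$ associated with $d$ is an $(n,C(n))$-metric for a constant $C(n)\ge 1$.
   Context: Setting. Consider a family of finite probability spaces indexed by $i$; the $i$-th has finite sample space $\Omega^i=\{\Omega^i_1,\dots,\Omega^i_{|\Omega^i|}\}\subseteq\Omega$ with pairwise distinct elements ($\Omega^i_s=\Omega^i_t$ iff $s=t$), all subsets as events, and probability mass function $p^i$ with $p^i_s>0$ for every $s\in[|\Omega^i|]$, where $[m]=\{1,\dots,m\}$ and $p^i_s$ is the probability of $\Omega^i_s$. Metric. Let $d=\{d^{i,j}\}_{i,j}$ be a family of functions $d^{i,j}:\Omega^i\times\Omega^j\to\mathbb{R}$, and write $d^{i,j}_{s,t}=d^{i,j}(\Omega^i_s,\Omega^j_t)$. The family $d$ is a metric if for all indices $i,j,k$ and all $s\in[|\Omega^i|]$, $r\in[|\Omega^j|]$, $t\in[|\Omega^k|]$: (1) $d^{i,j}_{s,r}\ge 0$; (2) $d^{i,j}_{s,r}=d^{j,i}_{r,s}$; (3) $d^{i,j}_{s,r}=0$ iff $\Omega^i_s=\Omega^j_r$; (4) $d^{i,j}_{s,r}\le d^{i,k}_{s,t}+d^{k,j}_{t,r}$. Pairwise MMOT distance. For indices $i_1,\dots,i_n$, $$\mathcal{W}^{i_1,\dots,i_n}=\min_{r}\ \sum_{1\le a<b\le n}\Big(\sum_{s,t}\big(d^{i_a,i_b}_{s,t}\big)^{\ell}\,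 r^{i_a,i_b}_{s,t}\Big)^{1/\ell},$$ where the minimum is over all probability mass functions $r$ on $\Omega^{i_1}\times\cdots\times\Omega^{i_n}$ whose univariate marginal on the $a$-th coordinate is $p^{i_a}$ for every $a\in[n]$, and $r^{i_a,i_b}$ denotes the bivariate marginal of $r$ on coordinates $a$ and $b$. $(n,C(n))$-metric. $\mathcal{W}$ is an $(n,C(n))$-metric if for any $n+1$ probability spaces in the family, labelled $1,\dots,n+1$, and any permutation $\sigma$ of $\{1,\dots,n\}$: (1) $\mathcal{W}^{1,\dots,n}\ge 0$; (2) $\mathcal{W}^{1,\dots,n}=0$ iff for all $i,j\in[n]$ one has $p^i=p^j$ and $\Omega^i=\Omega^j$, meaning that $|\Omega^i|=|\Omega^j|$ and there is a bijection $b^{i,j}:[|\Omega^i|]\to[|\Omega^j|]$ with $p^i_s=p^j_{b^{i,j}(s)}$ and $\Omega^i_s=\Omega^j_{b^{i,j}(s)}$ for all $s$; (3) $\mathcal{W}^{1,\dots,n}=\mathcal{W}^{\sigma(1),\dots,\sigma(n)}$; (4) $C(n)\,\mathcal{W}^{1,\dots,n}\le\sum_{r=1}^{n}\mathcal{W}^{1,\dots,r-1,r+1,\dots,n+1}$. *)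

theory Defs
  imports "HOL-Probability.Probability_Mass_Function" "HOL-Combinatorics.Permutations"
begin

text \<open>
  A finite probability space is given by an enumeration of its points and the probabilities of the
  enumerated points, as a \<^typ>\<open>nat pmf\<close> on the positions \<open>1, \<dots>, npoints\<close>. That the support of this
  pmf is \<^emph>\<open>all\<close> of \<open>{1..npoints}\<close> says that every point has positive probability.
\<close>

record 'w finite_space =
  npoints :: nat
  point :: "nat \<Rightarrow> 'w"
  prob :: "nat pmf"

definition positions :: "'w finite_space \<Rightarrow> nat set" where
  "positions X = {1..npoints X}"

definition finite_prob_space :: "'w finite_space \<Rightarrow> bool" where
  "finite_prob_space X \<longleftrightarrow> set_pmf (prob X) = positions X \<and> inj_on (point X) (positions X)"

definition same_space :: "'w finite_space \<Rightarrow> 'w finite_space \<Rightarrow> bool" where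
  "same_space X Y \<longleftrightarrow> npoints X = npoints Y \<and>
     (\<exists>b. bij_betw b (positions X) (positions Y) \<and>
        (\<forall>s\<in>positions X. pmf (prob X) s = pmf (prob Y) (b s) \<and> point X s = point Y (b s)))"

definition dist_at ::
    "('i \<Rightarrow> 'w finite_space) \<Rightarrow> ('i \<Rightarrow> 'i \<Rightarrow> 'w \<Rightarrow> 'w \<Rightarrow> real) \<Rightarrow> 'i \<Rightarrow> 'i \<Rightarrow> nat \<Rightarrow> nat \<Rightarrow> real" where
  "dist_at F d i j s t = d i j (point (F i) s) (point (F j) t)"

definition metric_family ::
    "('i \<Rightarrow> 'w finite_space) \<Rightarrow> ('i \<Rightarrow> 'i \<Rightarrow> 'w \<Rightarrow> 'w \<Rightarrow> real) \<Rightarrow> bool" where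
  "metric_family F d \<longleftrightarrow>
     (\<forall>i j k. \<forall>s\<in>positions (F i). \<forall>r\<in>positions (F j). \<forall>t\<in>positions (F k).
        dist_at F d i j s r \<ge> 0 \<and>
        dist_at F d i j s r = dist_at F d j i r s \<and>
        (dist_at F d i j s r = 0 \<longleftrightarrow> point (F i) s = point (F j) r) \<and>
        dist_at F d i j s r \<le> dist_at F d i k s t + dist_at F d k j t r)"

text \<open>
  A tuple of indices \<open>i\<^sub>1, \<dots>, i\<^sub>n\<close> is a function \<open>i\<close> on \<^typ>\<open>nat\<close> of which only the values on \<open>{1..n}\<close>
  matter; likewise an element of the product of the spaces is a tuple of positions,
  extensional outside \<open>{1..n}\<close>.
\<close>

definition couplings :: "('i \<Rightarrow> 'w finite_space) \<Rightarrow> nat \<Rightarrow> (nat \<Rightarrow> 'i) \<Rightarrow> (nat \<Rightarrow> nat) pmf set" where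
  "couplings F n i =
     {r. set_pmf r \<subseteq> (\<Pi>\<^sub>E a\<in>{1..n}. positions (F (i a))) \<and>
         (\<forall>a\<in>{1..n}. map_pmf (\<lambda>x. x a) r = prob (F (i a)))}"

definition bimarginal :: "(nat \<Rightarrow> nat) pmf \<Rightarrow> nat \<Rightarrow> nat \<Rightarrow> (nat \<times> nat) pmf" where
  "bimarginal r a b = map_pmf (\<lambda>x. (x a, x b)) r"

definition transport_cost ::
    "('i \<Rightarrow> 'w finite_space) \<Rightarrow> ('i \<Rightarrow> 'i \<Rightarrow> 'w \<Rightarrow> 'w \<Rightarrow> real) \<Rightarrow> nat \<Rightarrow> nat \<Rightarrow> (nat \<Rightarrow> 'i) \<Rightarrow>
       (nat \<Rightarrow> nat) pmf \<Rightarrow> real" where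
  "transport_cost F d l n i r =
     (\<Sum>a\<in>{1..n}. \<Sum>b\<in>{a<..n}.
        (\<Sum>s\<in>positions (F (i a)). \<Sum>t\<in>positions (F (i b)).
           dist_at F d (i a) (i b) s t ^ l * pmf (bimarginal r a b) (s, t)) powr (1 / real l))"

text \<open>
  \<open>LEAST\<close> on \<^typ>\<open>real\<close> denotes a minimum, not an infimum: it is unspecified unless the minimum is
  attained.
\<close>

definition pairwise_mmot ::
    "('i \<Rightarrow> 'w finite_space) \<Rightarrow> ('i \<Rightarrow> 'i \<Rightarrow> 'w \<Rightarrow> 'w \<Rightarrow> real) \<Rightarrow> nat \<Rightarrow> nat \<Rightarrow> (nat \<Rightarrow> 'i) \<Rightarrow> real" where
  "pairwise_mmot F d l n i = (LEAST w. \<exists>r\<in>couplings F n i. w = transport_cost F d l n i r)"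

definition omit :: "nat \<Rightarrow> (nat \<Rightarrow> 'i) \<Rightarrow> nat \<Rightarrow> 'i" where
  "omit r i = (\<lambda>a. if a < r then i a else i (Suc a))"

text \<open>
  The tuple \<open>i\<close> below labels \<open>n + 1\<close> spaces, of which \<open>W i\<close> sees the first \<open>n\<close>; \<open>omit r i\<close> drops the
  \<open>r\<close>-th label, so that \<open>W (omit r i)\<close> sees the remaining \<open>n\<close>, including the last.
\<close>

definition n_metric ::
    "('i \<Rightarrow> 'w finite_space) \<Rightarrow> nat \<Rightarrow> real \<Rightarrow> ((nat \<Rightarrow> 'i) \<Rightarrow> real) \<Rightarrow> bool" where
  "n_metric F n C W \<longleftrightarrow>
     (\<forall>i \<sigma>. \<sigma> permutes {1..n} \<longrightarrow>
        W i \<ge> 0 \<and>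
        (W i = 0 \<longleftrightarrow> (\<forall>a\<in>{1..n}. \<forall>b\<in>{1..n}. same_space (F (i a)) (F (i b)))) \<and>
        W i = W (i \<circ> \<sigma>) \<and>
        C * W i \<le> (\<Sum>r\<in>{1..n}. W (omit r i)))"

end

theory Submission
  imports Defs "HOL-Probability.Product_PMF"
begin

text \<open>
  The constant is \<open>C = 1\<close>. Take optimal couplings \<open>\<rho>\<^sub>r\<close> of the spaces \<open>1, \<dots>, n + 1\<close> without the \<open>r\<close>-th
  one, and let \<open>k < n\<close> minimise the cost of \<open>\<rho>\<^sub>k\<close>. Glue \<open>\<rho>\<^sub>n\<close> and \<open>\<rho>\<^sub>k\<close> along their common last
  space \<open>n + 1\<close> and keep the coordinates \<open>1, \<dots>, n - 1\<close> from \<open>\<rho>\<^sub>n\<close> and \<open>n\<close> from \<open>\<rho>\<^sub>k\<close>. By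
  Minkowski's inequality the pair \<open>(a, n)\<close> costs at most what \<open>(a, n + 1)\<close> costs under \<open>\<rho>\<^sub>n\<close>
  plus what \<open>(n, n + 1)\<close> costs under \<open>\<rho>\<^sub>k\<close>. Summing over all pairs, the glued coupling
  costs at most the cost of \<open>\<rho>\<^sub>n\<close> plus \<open>n - 1\<close> times the cost of \<open>\<rho>\<^sub>k\<close>, and by the choice of \<open>k\<close>
  the latter is at most the sum of the costs of \<open>\<rho>\<^sub>1, \<dots>, \<rho>\<^bsub>n-1\<^esub>\<close>.
\<close>

section \<open>Lp norms of finitely supported distributions\<close>

text \<open>The norm is taken over a distribution on an arbitrary type. Pushing a distribution
  forward then amounts to composing the integrand, so norms under different couplings can be
  compared under one glued distribution.\<close>

definition lp_norm :: "nat \<Rightarrow> 'a pmf \<Rightarrow> ('a \<Rightarrow> real) \<Rightarrow> real" where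
  "lp_norm l p f = measure_pmf.expectation p (\<lambda>x. f x ^ l) powr (1 / real l)"

lemma lp_norm_nonneg: "0 \<le> lp_norm l p f"
  by (simp add: lp_norm_def)

lemma lp_norm_map_pmf: "lp_norm l (map_pmf h p) f = lp_norm l p (\<lambda>x. f (h x))"
  by (simp add: lp_norm_def)

lemma lp_norm_cong:
  assumes "\<And>x. x \<in> set_pmf p \<Longrightarrow> f x = g x"
  shows "lp_norm l p f = lp_norm l p g"
proof -
  have "measure_pmf.expectation p (\<lambda>x. f x ^ l) = measure_pmf.expectation p (\<lambda>x. g x ^ l)"
    by (rule integral_cong_AE) (auto simp: AE_measure_pmf_iff assms)
  then show ?thesis by (simp add: lp_norm_def)
qed

lemma lp_norm_mono:
  assumes "finite (set_pmf p)"
    and "\<And>x. x \<in> set_pmf p \<Longrightarrow> 0 \<le> f x" "\<And>x. x \<in> set_pmf p \<Longrightarrow> f x \<le> g x"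
  shows "lp_norm l p f \<le> lp_norm l p g"
proof -
  have "measure_pmf.expectation p (\<lambda>x. f x ^ l) \<le> measure_pmf.expectation p (\<lambda>x. g x ^ l)"
    by (intro integral_mono_AE integrable_measure_pmf_finite)
      (auto simp: AE_measure_pmf_iff assms intro!: power_mono)
  moreover have "0 \<le> measure_pmf.expectation p (\<lambda>x. f x ^ l)"
    by (intro integral_nonneg_AE) (auto simp: AE_measure_pmf_iff assms)
  ultimately show ?thesis
    by (auto simp: lp_norm_def intro!: powr_mono2)
qed

lemma lp_norm_eq_0_iff:
  assumes "finite (set_pmf p)" "l \<ge> 1" "\<And>x. x \<in> set_pmf p \<Longrightarrow> 0 \<le> f x"
  shows "lp_norm l p f = 0 \<longleftrightarrow> (\<forall>x\<in>set_pmf p. f x = 0)"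
proof -
  have "measure_pmf.expectation p (\<lambda>x. f x ^ l) = (\<Sum>x\<in>set_pmf p. f x ^ l * pmf p x)"
    using assms(1) by (intro integral_measure_pmf_real) auto
  then have "lp_norm l p f = 0 \<longleftrightarrow> (\<Sum>x\<in>set_pmf p. f x ^ l * pmf p x) = 0"
    by (simp add: lp_norm_def)
  also have "\<dots> \<longleftrightarrow> (\<forall>x\<in>set_pmf p. f x ^ l * pmf p x = 0)"
    using assms by (intro sum_nonneg_eq_0_iff) auto
  also have "\<dots> \<longleftrightarrow> (\<forall>x\<in>set_pmf p. f x = 0)"
    using assms by (auto simp: set_pmf_iff)
  finally show ?thesis .
qed

lemma convex_on_power_nonneg: "convex_on {0::real..} (\<lambda>x. x ^ n)"
  by (cases "even n") (auto intro: convex_power_odd convex_on_subset[OF convex_power_even])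

text \<open>Removes the root: both sides are nonnegative, so they may be raised to the power
  \<open>l\<close>. Minkowski's inequality thereby becomes a bound on a moment, which convexity can
  deliver pointwise.\<close>

lemma lp_norm_le_iff:
  assumes "l \<ge> 1" "0 \<le> measure_pmf.expectation p (\<lambda>x. f x ^ l)" "0 \<le> A"
  shows "lp_norm l p f \<le> A \<longleftrightarrow> measure_pmf.expectation p (\<lambda>x. f x ^ l) \<le> A ^ l"
proof -
  let ?E = "measure_pmf.expectation p (\<lambda>x. f x ^ l)"
  \<comment> \<open>A zero moment is separate because the laws for real powers need a positive base;
    there both sides vanish since \<open>l\<close> is positive.\<close>
  have "lp_norm l p f ^ l = ?E"
    using assms by (cases "?E = 0") (auto simp: lp_norm_def powr_realpow' powr_powr simp flip: powr_realpow)
  then show ?thesis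
    using assms power_mono_iff[of "lp_norm l p f" A l] lp_norm_nonneg[of l p f] by auto
qed

text \<open>
  Minkowski's inequality. The bounds \<open>A\<close>, \<open>B\<close> are taken strictly larger than the norms so
  that they are nonzero; \<open>((f + g) / (A + B))\<^sup>l\<close> is then, by convexity, at most the
  average of \<open>(f / A)\<^sup>l\<close> and \<open>(g / B)\<^sup>l\<close> with weights \<open>A / (A + B)\<close> and \<open>B / (A + B)\<close>.
\<close>

lemma lp_norm_add:
  assumes fin: "finite (set_pmf p)" and l: "l \<ge> 1"
    and f: "\<And>x. x \<in> set_pmf p \<Longrightarrow> 0 \<le> f x" and g: "\<And>x. x \<in> set_pmf p \<Longrightarrow> 0 \<le> g x"
  shows "lp_norm l p (\<lambda>x. f x + g x) \<le> lp_norm l p f + lp_norm l p g"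
proof (rule field_le_epsilon)
  fix e :: real assume e: "0 < e"
  let ?E = "measure_pmf.expectation p"
  have int: "integrable (measure_pmf p) h" for h :: "'a \<Rightarrow> real"
    using fin by (rule integrable_measure_pmf_finite)
  have nn: "0 \<le> ?E (\<lambda>x. h x ^ l)" if "\<And>x. x \<in> set_pmf p \<Longrightarrow> 0 \<le> h x" for h :: "'a \<Rightarrow> real"
    by (intro integral_nonneg_AE) (auto simp: AE_measure_pmf_iff that)
  define A where "A = lp_norm l p f + e / 2"
  define B where "B = lp_norm l p g + e / 2"
  have A: "A > 0" and B: "B > 0"
    using e lp_norm_nonneg[of l p f] lp_norm_nonneg[of l p g] by (auto simp: A_def B_def)
  have fA: "?E (\<lambda>x. f x ^ l) \<le> A ^ l"
    using lp_norm_le_iff[of l p f A] l nn[of f] f A e by (simp add: A_def)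
  have gB: "?E (\<lambda>x. g x ^ l) \<le> B ^ l"
    using lp_norm_le_iff[of l p g B] l nn[of g] g B e by (simp add: B_def)
  have conv: "((f x + g x) / (A + B)) ^ l
      \<le> A / (A + B) * (f x ^ l / A ^ l) + B / (A + B) * (g x ^ l / B ^ l)"
    if x: "x \<in> set_pmf p" for x
  proof -
    have t: "1 - B / (A + B) = A / (A + B)" using A B by (simp add: field_simps)
    have "(f x + g x) / (A + B) = (1 - B / (A + B)) * (f x / A) + B / (A + B) * (g x / B)"
      unfolding t using A B by (simp add: add_divide_distrib)
    also have "\<dots> ^ l \<le> (1 - B / (A + B)) * (f x / A) ^ l + B / (A + B) * (g x / B) ^ l"
      using convex_onD[OF convex_on_power_nonneg[of l], of "B / (A + B)" "f x / A" "g x / B"]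
        A B f[OF x] g[OF x] by simp
    finally show ?thesis unfolding t by (simp add: power_divide)
  qed
  have "?E (\<lambda>x. (f x + g x) ^ l) / (A + B) ^ l = ?E (\<lambda>x. ((f x + g x) / (A + B)) ^ l)"
    by (simp add: power_divide)
  also have "\<dots> \<le> ?E (\<lambda>x. A / (A + B) * (f x ^ l / A ^ l) + B / (A + B) * (g x ^ l / B ^ l))"
    by (intro integral_mono_AE int AE_pmfI conv)
  also have "\<dots> = A / (A + B) * (?E (\<lambda>x. f x ^ l) / A ^ l) + B / (A + B) * (?E (\<lambda>x. g x ^ l) / B ^ l)"
    by (simp only: Bochner_Integration.integral_add[OF int int] integral_mult_right_zero
        integral_divide_zero)
  also have "\<dots> \<le> A / (A + B) * 1 + B / (A + B) * 1"
    using A B fA gB by (intro add_mono mult_left_mono) auto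
  also have "\<dots> = 1" using A B by (simp flip: add_divide_distrib)
  finally have "?E (\<lambda>x. (f x + g x) ^ l) \<le> (A + B) ^ l"
    using A B by (simp add: divide_le_eq)
  then have "lp_norm l p (\<lambda>x. f x + g x) \<le> A + B"
    using lp_norm_le_iff[of l p "\<lambda>x. f x + g x" "A + B"] l nn[of "\<lambda>x. f x + g x"] f g A B by simp
  then show "lp_norm l p (\<lambda>x. f x + g x) \<le> lp_norm l p f + lp_norm l p g + e"
    by (simp add: A_def B_def)
qed

section \<open>Sums over ordered pairs of coordinates\<close>

definition pair_sum :: "nat \<Rightarrow> (nat \<Rightarrow> nat \<Rightarrow> real) \<Rightarrow> real" where
  "pair_sum n g = (\<Sum>a\<in>{1..n}. \<Sum>b\<in>{a<..n}. g a b)"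

lemma pair_sum_cong:
  assumes "\<And>a b. 1 \<le> a \<Longrightarrow> a < b \<Longrightarrow> b \<le> n \<Longrightarrow> g a b = h a b"
  shows "pair_sum n g = pair_sum n h"
  unfolding pair_sum_def by (intro sum.cong) (auto intro: assms)

lemma pair_sum_nonneg:
  assumes "\<And>a b. 0 \<le> g a b"
  shows "0 \<le> pair_sum n g"
  unfolding pair_sum_def by (intro sum_nonneg assms)

lemma pair_sum_eq_0_iff:
  assumes "\<And>a b. 0 \<le> g a b"
  shows "pair_sum n g = 0 \<longleftrightarrow> (\<forall>a b. 1 \<le> a \<longrightarrow> a < b \<longrightarrow> b \<le> n \<longrightarrow> g a b = 0)"
  unfolding pair_sum_def
  by (subst sum_nonneg_eq_0_iff; (simp add: sum_nonneg assms)?)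
    (subst sum_nonneg_eq_0_iff; (auto simp: assms)?)

lemma pair_sum_Suc:
  "pair_sum (Suc m) g = pair_sum m g + (\<Sum>a\<in>{1..m}. g a (Suc m))"
proof -
  have "pair_sum (Suc m) g = (\<Sum>a\<in>{1..m}. \<Sum>b\<in>{a<..Suc m}. g a b)"
    by (simp add: pair_sum_def)
  also have "\<dots> = (\<Sum>a\<in>{1..m}. (\<Sum>b\<in>{a<..m}. g a b) + g a (Suc m))"
  proof (intro sum.cong refl)
    fix a assume "a \<in> {1..m}"
    then have "{a<..Suc m} = insert (Suc m) {a<..m}" by auto
    then show "(\<Sum>b\<in>{a<..Suc m}. g a b) = (\<Sum>b\<in>{a<..m}. g a b) + g a (Suc m)" by simp
  qed
  finally show ?thesis by (simp add: pair_sum_def sum.distrib)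
qed

lemma member_le_pair_sum:
  assumes "\<And>a b. 0 \<le> g a b" "1 \<le> a" "a < b" "b \<le> n"
  shows "g a b \<le> pair_sum n g"
proof -
  have "g a b \<le> (\<Sum>b\<in>{a<..n}. g a b)"
    using assms by (intro member_le_sum) auto
  also have "\<dots> \<le> pair_sum n g"
    unfolding pair_sum_def using assms
    by (intro member_le_sum[of a _ "\<lambda>a. \<Sum>b\<in>{a<..n}. g a b"]) (auto intro: sum_nonneg)
  finally show ?thesis .
qed

text \<open>The full square counts each unordered pair twice and the diagonal once. Unlike the sum
  over \<open>a < b\<close>, it does not refer to the order of the coordinates.\<close>

lemma double_pair_sum:
  assumes sym: "\<And>a b. a \<in> {1..n} \<Longrightarrow> b \<in> {1..n} \<Longrightarrow> g a b = g b a"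
  shows "2 * pair_sum n g = (\<Sum>a\<in>{1..n}. \<Sum>b\<in>{1..n}. g a b) - (\<Sum>a\<in>{1..n}. g a a)"
  using sym
proof (induction n)
  case 0
  then show ?case by (simp add: pair_sum_def)
next
  case (Suc m)
  have "2 * pair_sum m g = (\<Sum>a\<in>{1..m}. \<Sum>b\<in>{1..m}. g a b) - (\<Sum>a\<in>{1..m}. g a a)"
    using Suc.prems by (intro Suc.IH) auto
  moreover have "(\<Sum>b\<in>{1..m}. g (Suc m) b) = (\<Sum>a\<in>{1..m}. g a (Suc m))"
    using Suc.prems by (intro sum.cong) auto
  ultimately show ?case
    by (simp add: pair_sum_Suc sum.distrib)
qed

text \<open>A permutation need not preserve \<open>a < b\<close>. In the full square, rows, columns
  and diagonal can each be reindexed on their own.\<close>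

lemma pair_sum_permute:
  assumes \<sigma>: "\<sigma> permutes {1..n}"
    and sym: "\<And>a b. a \<in> {1..n} \<Longrightarrow> b \<in> {1..n} \<Longrightarrow> g a b = g b a"
  shows "pair_sum n (\<lambda>a b. g (\<sigma> a) (\<sigma> b)) = pair_sum n g"
proof -
  have "2 * pair_sum n (\<lambda>a b. g (\<sigma> a) (\<sigma> b)) =
      (\<Sum>a\<in>{1..n}. \<Sum>b\<in>{1..n}. g (\<sigma> a) (\<sigma> b)) - (\<Sum>a\<in>{1..n}. g (\<sigma> a) (\<sigma> a))"
    using permutes_in_image[OF \<sigma>] by (intro double_pair_sum sym) auto
  also have "(\<Sum>a\<in>{1..n}. \<Sum>b\<in>{1..n}. g (\<sigma> a) (\<sigma> b)) = (\<Sum>a\<in>{1..n}. \<Sum>b\<in>{1..n}. g (\<sigma> a) b)"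
  proof (rule sum.cong[OF refl])
    fix a
    show "(\<Sum>b\<in>{1..n}. g (\<sigma> a) (\<sigma> b)) = (\<Sum>b\<in>{1..n}. g (\<sigma> a) b)"
      using sum.permute[OF \<sigma>, of "g (\<sigma> a)"] by (simp add: o_def)
  qed
  also have "\<dots> = (\<Sum>a\<in>{1..n}. \<Sum>b\<in>{1..n}. g a b)"
    using sum.permute[OF \<sigma>, of "\<lambda>a. \<Sum>b\<in>{1..n}. g a b"] by (simp add: o_def)
  also have "(\<Sum>a\<in>{1..n}. g (\<sigma> a) (\<sigma> a)) = (\<Sum>a\<in>{1..n}. g a a)"
    using sum.permute[OF \<sigma>, of "\<lambda>a. g a a"] by (simp add: o_def)
  finally show ?thesis
    using double_pair_sum[of n g] sym by simp
qed

section \<open>Distributions on a finite set\<close>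

lemma pmf_surj_on_finite:
  assumes "finite S" "\<And>x. 0 \<le> f x" "\<And>x. x \<notin> S \<Longrightarrow> f x = 0" "sum f S = 1"
  obtains p where "set_pmf p \<subseteq> S" "pmf p = f"
proof
  have "(\<integral>\<^sup>+x. ennreal (f x) \<partial>count_space UNIV) = (\<Sum>x\<in>S. ennreal (f x))"
    using assms(1,3) by (intro nn_integral_count_space') auto
  also have "\<dots> = ennreal (sum f S)"
    using assms(2) by (intro sum_ennreal) auto
  finally have *: "(\<integral>\<^sup>+x. ennreal (f x) \<partial>count_space UNIV) = 1"
    using assms(4) by simp
  show "pmf (embed_pmf f) = f"
    using pmf_embed_pmf[OF assms(2) *] by auto
  show "set_pmf (embed_pmf f) \<subseteq> S"
    using set_embed_pmf[OF assms(2) *] assms(3) by auto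
qed

text \<open>The simplex is a closed subset of a cube, which is compact by Tychonoff's theorem. The
  product topology on all functions is used because the underlying type may be infinite even though
  \<open>S\<close> is finite.\<close>

lemma compact_pmf_image:
  fixes S :: "'a set"
  assumes "finite S"
  shows "compact (pmf ` {p. set_pmf p \<subseteq> S})"
proof -
  let ?K = "{f. (\<forall>x. 0 \<le> f x) \<and> (\<forall>x. x \<notin> S \<longrightarrow> f x = 0) \<and> sum f S = (1::real)}"
  have "pmf ` {p. set_pmf p \<subseteq> S} = ?K"
  proof (intro equalityI subsetI)
    fix f assume "f \<in> ?K"
    then show "f \<in> pmf ` {p. set_pmf p \<subseteq> S}"
      using pmf_surj_on_finite[OF assms, of f] by blast
  qed (use assms in \<open>auto simp: sum_pmf_eq_1 set_pmf_iff\<close>)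
  moreover have "compact ?K"
  proof -
    have "compact (PiE UNIV (\<lambda>_. {0..1}) :: ('a \<Rightarrow> real) set)"
      using compactin_PiE[of "\<lambda>_. euclidean" "UNIV :: 'a set" "\<lambda>_. {0..1::real}"]
      by (simp add: euclidean_product_topology)
    moreover have "closed ?K"
      by (intro closed_Collect_conj closed_Collect_all closed_Collect_imp closed_Collect_le
          closed_Collect_eq continuous_intros continuous_on_product_coordinates) auto
    moreover have "?K \<subseteq> PiE UNIV (\<lambda>_. {0..1})"
    proof
      fix f :: "'a \<Rightarrow> real" assume f: "f \<in> ?K"
      have "f x \<le> 1" for x
        using f assms member_le_sum[of x S f] by (cases "x \<in> S") auto
      with f show "f \<in> PiE UNIV (\<lambda>_. {0..1})" by auto
    qed
    ultimately show ?thesis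
      using compact_Int_closed[of "PiE UNIV (\<lambda>_. {0..1})" ?K] by (simp add: Int_absorb1)
  qed
  ultimately show ?thesis by simp
qed

text \<open>Makes each marginal a finite linear expression in the masses, hence continuous in the
  mass function.\<close>

lemma pmf_map_finite:
  assumes "finite S" "set_pmf p \<subseteq> S"
  shows "pmf (map_pmf f p) y = (\<Sum>x | x \<in> S \<and> f x = y. pmf p x)"
proof -
  have "pmf (map_pmf f p) y = measure p {x \<in> S. f x = y}"
    unfolding pmf_map using assms(2)
    by (intro measure_pmf.finite_measure_eq_AE) (auto simp: AE_measure_pmf_iff)
  also have "\<dots> = (\<Sum>x | x \<in> S \<and> f x = y. pmf p x)"
    using assms(1) by (intro measure_measure_pmf_finite) auto
  finally show ?thesis .
qed

section \<open>Finite probability spaces\<close>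

lemma finite_positions [simp]: "finite (positions X)"
  by (simp add: positions_def)

text \<open>Transporting the law from positions to points removes the choice of enumeration. Since
  enumerations are injective and all positions have positive mass, the law of the point determines
  the space up to relabelling.\<close>

lemma same_space_iff:
  assumes X: "finite_prob_space X" and Y: "finite_prob_space Y"
  shows "same_space X Y \<longleftrightarrow> map_pmf (point X) (prob X) = map_pmf (point Y) (prob Y)"
proof
  assume "same_space X Y"
  then obtain b where b: "bij_betw b (positions X) (positions Y)"
    and eq: "\<And>s. s \<in> positions X \<Longrightarrow> pmf (prob X) s = pmf (prob Y) (b s) \<and> point X s = point Y (b s)"
    unfolding same_space_def by blast
  have sX: "set_pmf (prob X) = positions X" and sY: "set_pmf (prob Y) = positions Y"
    using X Y by (auto simp: finite_prob_space_def)
  have "map_pmf b (prob X) = prob Y"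
  proof (rule pmf_eqI)
    fix t
    show "pmf (map_pmf b (prob X)) t = pmf (prob Y) t"
    proof (cases "t \<in> positions Y")
      case True
      then obtain s where s: "s \<in> positions X" "t = b s"
        using b by (auto simp: bij_betw_def)
      then show ?thesis
        using eq b by (simp add: pmf_map_inj sX bij_betw_def)
    next
      case False
      then have "t \<notin> set_pmf (map_pmf b (prob X))" "t \<notin> set_pmf (prob Y)"
        using b by (auto simp: sX sY bij_betw_def)
      then show ?thesis unfolding set_pmf_iff by simp
    qed
  qed
  moreover have "map_pmf (point X) (prob X) = map_pmf (point Y \<circ> b) (prob X)"
    using eq by (intro map_pmf_cong) (auto simp: sX)
  ultimately show "map_pmf (point X) (prob X) = map_pmf (point Y) (prob Y)"
    by (simp flip: map_pmf_comp add: o_def)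
next
  assume eq: "map_pmf (point X) (prob X) = map_pmf (point Y) (prob Y)"
  have sX: "set_pmf (prob X) = positions X" and sY: "set_pmf (prob Y) = positions Y"
    and iX: "inj_on (point X) (positions X)" and iY: "inj_on (point Y) (positions Y)"
    using X Y by (auto simp: finite_prob_space_def)
  have img: "point X ` positions X = point Y ` positions Y"
    using arg_cong[OF eq, of set_pmf] by (simp add: sX sY)
  \<comment> \<open>Each position of \<open>X\<close> goes to the position at which \<open>Y\<close>
    lists the same point; the supports of the two laws agree, so there is one.\<close>
  define b where "b = inv_into (positions Y) (point Y) \<circ> point X"
  have b: "bij_betw b (positions X) (positions Y)"
    unfolding b_def using iX iY img
    by (intro bij_betw_trans[of _ _ "point X ` positions X"] bij_betw_imageI bij_betw_inv_into)
      (auto simp: bij_betw_def intro: inj_on_inv_into)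
  moreover have "npoints X = npoints Y"
    using bij_betw_same_card[OF b] by (simp add: positions_def)
  moreover have "pmf (prob X) s = pmf (prob Y) (b s) \<and> point X s = point Y (b s)"
    if s: "s \<in> positions X" for s
  proof -
    have pt: "point Y (b s) = point X s"
      using s img f_inv_into_f[of "point X s" "point Y" "positions Y"] by (auto simp: b_def)
    have bs: "b s \<in> positions Y"
      using b s by (auto simp: bij_betw_def)
    have "pmf (prob X) s = pmf (map_pmf (point X) (prob X)) (point X s)"
      using iX s by (simp add: pmf_map_inj sX)
    also have "\<dots> = pmf (map_pmf (point Y) (prob Y)) (point Y (b s))"
      by (simp add: eq pt)
    also have "\<dots> = pmf (prob Y) (b s)"
      using iY bs by (simp add: pmf_map_inj sY)
    finally show ?thesis using pt by simp
  qed
  ultimately show "same_space X Y"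
    unfolding same_space_def by blast
qed

section \<open>Properties of the pairwise distance\<close>

locale metric_spaces =
  fixes F :: "'i \<Rightarrow> 'w finite_space"
    and d :: "'i \<Rightarrow> 'i \<Rightarrow> 'w \<Rightarrow> 'w \<Rightarrow> real"
    and l :: nat
  assumes spaces: "\<And>i. finite_prob_space (F i)"
    and metric: "metric_family F d"
    and l_pos: "l \<ge> 1"
begin

abbreviation tuples :: "nat \<Rightarrow> (nat \<Rightarrow> 'i) \<Rightarrow> (nat \<Rightarrow> nat) set" where
  "tuples n i \<equiv> \<Pi>\<^sub>E a\<in>{1..n}. positions (F (i a))"

abbreviation dst :: "(nat \<Rightarrow> 'i) \<Rightarrow> nat \<Rightarrow> nat \<Rightarrow> (nat \<Rightarrow> nat) \<Rightarrow> real" where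
  "dst i a b x \<equiv> dist_at F d (i a) (i b) (x a) (x b)"

abbreviation W :: "nat \<Rightarrow> (nat \<Rightarrow> 'i) \<Rightarrow> real" where
  "W \<equiv> pairwise_mmot F d l"

lemma set_prob: "set_pmf (prob (F i)) = positions (F i)"
  and inj_on_point: "inj_on (point (F i)) (positions (F i))"
  using spaces[of i] by (auto simp: finite_prob_space_def)

lemma dist_nonneg: "s \<in> positions (F i) \<Longrightarrow> t \<in> positions (F j) \<Longrightarrow> 0 \<le> dist_at F d i j s t"
  and dist_sym: "s \<in> positions (F i) \<Longrightarrow> t \<in> positions (F j) \<Longrightarrow>
    dist_at F d i j s t = dist_at F d j i t s"
  and dist_eq_0_iff: "s \<in> positions (F i) \<Longrightarrow> t \<in> positions (F j) \<Longrightarrow>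
    dist_at F d i j s t = 0 \<longleftrightarrow> point (F i) s = point (F j) t"
  and dist_triangle: "s \<in> positions (F i) \<Longrightarrow> t \<in> positions (F j) \<Longrightarrow> u \<in> positions (F k) \<Longrightarrow>
    dist_at F d i j s t \<le> dist_at F d i k s u + dist_at F d k j u t"
  using metric unfolding metric_family_def by blast+

lemma finite_tuples: "finite (tuples n i)"
  by (intro finite_PiE) auto

lemma couplingD:
  assumes "r \<in> couplings F n i"
  shows "finite (set_pmf r)" "set_pmf r \<subseteq> tuples n i"
    "a \<in> {1..n} \<Longrightarrow> map_pmf (\<lambda>x. x a) r = prob (F (i a))"
    "x \<in> set_pmf r \<Longrightarrow> a \<in> {1..n} \<Longrightarrow> x a \<in> positions (F (i a))"
proof -
  show sub: "set_pmf r \<subseteq> tuples n i"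
    using assms by (simp add: couplings_def)
  show "finite (set_pmf r)"
    using sub finite_tuples by (rule finite_subset)
  show "map_pmf (\<lambda>x. x a) r = prob (F (i a))" if "a \<in> {1..n}"
    using assms that by (simp add: couplings_def)
  show "x a \<in> positions (F (i a))" if "x \<in> set_pmf r" "a \<in> {1..n}"
    using sub that by (blast dest: PiE_mem)
qed

lemma dst_nonneg:
  assumes "r \<in> couplings F n i" "x \<in> set_pmf r" "a \<in> {1..n}" "b \<in> {1..n}"
  shows "0 \<le> dst i a b x"
  using assms by (intro dist_nonneg couplingD(4))

text \<open>Summing against a bivariate marginal is taking an expectation under the coupling itself,
  so each pair contributes an Lp norm.\<close>

lemma transport_cost_eq:
  assumes r: "r \<in> couplings F n i"
  shows "transport_cost F d l n i r = pair_sum n (\<lambda>a b. lp_norm l r (dst i a b))"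
  unfolding transport_cost_def pair_sum_def lp_norm_def
proof (intro sum.cong refl arg_cong[where f = "\<lambda>u. u powr _"])
  fix a b assume ab: "a \<in> {1..n}" "b \<in> {a<..n}"
  let ?A = "positions (F (i a))" and ?B = "positions (F (i b))"
  let ?h = "\<lambda>(s, t). dist_at F d (i a) (i b) s t ^ l"
  have "(\<Sum>s\<in>?A. \<Sum>t\<in>?B. dist_at F d (i a) (i b) s t ^ l * pmf (bimarginal r a b) (s, t))
      = (\<Sum>z\<in>?A \<times> ?B. ?h z * pmf (bimarginal r a b) z)"
    by (simp add: sum.cartesian_product case_prod_beta)
  also have "\<dots> = measure_pmf.expectation (bimarginal r a b) ?h"
    using couplingD(4)[OF r] ab
    by (intro integral_measure_pmf_real[symmetric]) (auto simp: bimarginal_def)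
  also have "\<dots> = measure_pmf.expectation r (\<lambda>x. dst i a b x ^ l)"
    by (simp add: bimarginal_def)
  finally show "(\<Sum>s\<in>?A. \<Sum>t\<in>?B. dist_at F d (i a) (i b) s t ^ l * pmf (bimarginal r a b) (s, t))
      = measure_pmf.expectation r (\<lambda>x. dst i a b x ^ l)" .
qed

section \<open>Existence of optimal couplings\<close>

lemma couplings_nonempty: "couplings F n i \<noteq> {}"
proof -
  \<comment> \<open>The independent coupling; the default \<open>undefined\<close> makes its tuples
    extensional outside \<open>{1..n}\<close>.\<close>
  have "Pi_pmf {1..n} undefined (\<lambda>a. prob (F (i a))) \<in> couplings F n i"
    by (auto simp: couplings_def set_Pi_pmf PiE_dflt_def Pi_pmf_component set_prob PiE_def
        extensional_def)
  then show ?thesis by blast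
qed

lemma compact_couplings: "compact (pmf ` couplings F n i)"
proof -
  let ?S = "tuples n i"
  let ?C = "{f. \<forall>a s. a \<in> {1..n} \<longrightarrow> (\<Sum>x | x \<in> ?S \<and> x a = s. f x) = pmf (prob (F (i a))) s}"
  have "pmf ` couplings F n i = pmf ` {p. set_pmf p \<subseteq> ?S} \<inter> ?C"
    by (auto simp: couplings_def pmf_eq_iff pmf_map_finite[OF finite_tuples] image_iff)
  moreover have "closed ?C"
    by (intro closed_Collect_all closed_Collect_imp closed_Collect_eq continuous_intros
        continuous_on_product_coordinates) auto
  ultimately show ?thesis
    using compact_Int_closed[OF compact_pmf_image[OF finite_tuples]] by simp
qed

text \<open>A continuous cost on a nonempty compact set attains its minimum. This gives the
  \<open>LEAST\<close> in the distance its meaning.\<close>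

lemma optimal_coupling_exists:
  "\<exists>r\<in>couplings F n i. W n i = transport_cost F d l n i r \<and>
     (\<forall>q\<in>couplings F n i. W n i \<le> transport_cost F d l n i q)"
proof -
  let ?S = "tuples n i"
  \<comment> \<open>The cost as a formula in finitely many values of an arbitrary function, so that
    continuity makes sense.\<close>
  define G where "G f = pair_sum n (\<lambda>a b. (\<Sum>x\<in>?S. dst i a b x ^ l * f x) powr (1 / real l))" for f
  have G: "G (pmf r) = transport_cost F d l n i r" if r: "r \<in> couplings F n i" for r
  proof -
    have "measure_pmf.expectation r (\<lambda>x. dst i a b x ^ l) = (\<Sum>x\<in>?S. dst i a b x ^ l * pmf r x)"
      for a b
      using couplingD(2)[OF r] by (intro integral_measure_pmf_real finite_tuples) auto
    then show ?thesis
      by (simp add: G_def transport_cost_eq[OF r] lp_norm_def)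
  qed
  \<comment> \<open>The root is continuous on nonnegative arguments, including 0, since its exponent
    is positive.\<close>
  have nn: "0 \<le> (\<Sum>x\<in>?S. dst i a b x ^ l * f x)"
    if "f \<in> pmf ` couplings F n i" "a \<in> {1..n}" "b \<in> {a<..n}" for f a b
    using that by (intro sum_nonneg mult_nonneg_nonneg zero_le_power dist_nonneg) auto
  have "continuous_on (pmf ` couplings F n i) G"
    unfolding G_def pair_sum_def
    by (intro continuous_on_sum continuous_on_powr' continuous_on_mult continuous_on_const
        continuous_on_subset[OF continuous_on_product_coordinates]) (use nn l_pos in auto)
  then obtain f where f: "f \<in> pmf ` couplings F n i"
    and min: "\<And>g. g \<in> pmf ` couplings F n i \<Longrightarrow> G f \<le> G g"
    using continuous_attains_inf[OF compact_couplings, of n i G] couplings_nonempty[of n i] by auto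
  then obtain r where r: "r \<in> couplings F n i"
    "\<And>q. q \<in> couplings F n i \<Longrightarrow> transport_cost F d l n i r \<le> transport_cost F d l n i q"
    by (metis G imageE imageI)
  moreover have "W n i = transport_cost F d l n i r"
    unfolding pairwise_mmot_def using r by (intro Least_equality) auto
  ultimately show ?thesis by auto
qed

lemma optimal_coupling:
  obtains r where "r \<in> couplings F n i" "W n i = transport_cost F d l n i r"
  using optimal_coupling_exists by blast

lemma W_le_transport_cost: "q \<in> couplings F n i \<Longrightarrow> W n i \<le> transport_cost F d l n i q"
  using optimal_coupling_exists by blast

lemma W_nonneg: "0 \<le> W n i"
  by (rule optimal_coupling[of n i])
    (simp add: transport_cost_eq pair_sum_nonneg lp_norm_nonneg)

section \<open>Invariance under permutations\<close>

text \<open>Permuting the coordinates of an optimal coupling yields a coupling of the permuted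
  spaces, with the same cost because the distances are symmetric. The converse inequality follows by
  applying this to the inverse permutation.\<close>

lemma W_permute_le:
  assumes \<sigma>: "\<sigma> permutes {1..n}"
  shows "W n (i \<circ> \<sigma>) \<le> W n i"
proof -
  obtain r where r: "r \<in> couplings F n i" "W n i = transport_cost F d l n i r"
    by (rule optimal_coupling)
  have in\<sigma>: "\<sigma> a \<in> {1..n} \<longleftrightarrow> a \<in> {1..n}" for a
    using \<sigma> by (rule permutes_in_image)
  define q where "q = map_pmf (\<lambda>x. x \<circ> \<sigma>) r"
  have q: "q \<in> couplings F n (i \<circ> \<sigma>)"
    unfolding couplings_def
  proof (intro CollectI conjI ballI subsetI)
    fix y assume "y \<in> set_pmf q"
    then obtain x where x: "x \<in> set_pmf r" "y = x \<circ> \<sigma>"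
      by (auto simp: q_def)
    have xt: "x \<in> tuples n i"
      using x(1) couplingD(2)[OF r(1)] by blast
    show "y \<in> tuples n (i \<circ> \<sigma>)"
    proof (rule PiE_I)
      show "y a \<in> positions (F ((i \<circ> \<sigma>) a))" if "a \<in> {1..n}" for a
        using that xt in\<sigma>[of a] x(2) by (auto dest: PiE_mem)
      show "y a = undefined" if "a \<notin> {1..n}" for a
        using that xt in\<sigma>[of a] x(2) by (auto dest: PiE_arb)
    qed
  next
    fix a assume "a \<in> {1..n}"
    then show "map_pmf (\<lambda>x. x a) q = prob (F ((i \<circ> \<sigma>) a))"
      using couplingD(3)[OF r(1), of "\<sigma> a"] in\<sigma>[of a] by (simp add: q_def map_pmf_comp)
  qed
  have sym: "lp_norm l r (dst i a b) = lp_norm l r (dst i b a)"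
    if "a \<in> {1..n}" "b \<in> {1..n}" for a b
    using that couplingD(4)[OF r(1)] by (intro lp_norm_cong dist_sym) auto
  have "W n (i \<circ> \<sigma>) \<le> transport_cost F d l n (i \<circ> \<sigma>) q"
    using q by (rule W_le_transport_cost)
  also have "\<dots> = pair_sum n (\<lambda>a b. lp_norm l r (dst i (\<sigma> a) (\<sigma> b)))"
    by (simp add: transport_cost_eq[OF q]) (simp add: q_def lp_norm_map_pmf)
  also have "\<dots> = W n i"
    using pair_sum_permute[OF \<sigma>, of "\<lambda>a b. lp_norm l r (dst i a b)"] sym
    by (simp add: r(2) transport_cost_eq[OF r(1)])
  finally show ?thesis .
qed

lemma W_permute:
  assumes \<sigma>: "\<sigma> permutes {1..n}"
  shows "W n (i \<circ> \<sigma>) = W n i"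
proof (rule antisym)
  have "W n ((i \<circ> \<sigma>) \<circ> inv \<sigma>) \<le> W n (i \<circ> \<sigma>)"
    using permutes_inv[OF \<sigma>] by (rule W_permute_le)
  then show "W n i \<le> W n (i \<circ> \<sigma>)"
    by (simp add: o_assoc[symmetric] permutes_inv_o[OF \<sigma>])
qed (rule W_permute_le[OF \<sigma>])

section \<open>Vanishing of the distance\<close>

text \<open>Under an optimal coupling of cost zero, the points in all coordinates coincide almost
  surely, so their laws are equal.\<close>

lemma W_eq_0_imp_same_space:
  assumes "W n i = 0" "a \<in> {1..n}" "b \<in> {1..n}"
  shows "same_space (F (i a)) (F (i b))"
proof -
  obtain r where r: "r \<in> couplings F n i" "W n i = transport_cost F d l n i r"
    by (rule optimal_coupling)
  have eq: "point (F (i a)) (x a) = point (F (i b)) (x b)"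
    if "a \<in> {1..n}" "b \<in> {1..n}" "a < b" "x \<in> set_pmf r" for a b x
  proof -
    have "lp_norm l r (dst i a b) = 0"
      using assms(1) that unfolding r(2) transport_cost_eq[OF r(1)]
      by (subst (asm) pair_sum_eq_0_iff) (auto simp: lp_norm_nonneg)
    then have "dst i a b x = 0"
      using that l_pos couplingD(1)[OF r(1)] dst_nonneg[OF r(1)] by (subst (asm) lp_norm_eq_0_iff) auto
    then show ?thesis
      using that couplingD(4)[OF r(1)] by (subst (asm) dist_eq_0_iff) auto
  qed
  have "point (F (i a)) (x a) = point (F (i b)) (x b)" if "x \<in> set_pmf r" for x
    using that eq[of a b x] eq[of b a x] assms(2,3) by (cases a b rule: linorder_cases) auto
  then have "map_pmf (\<lambda>x. point (F (i a)) (x a)) r = map_pmf (\<lambda>x. point (F (i b)) (x b)) r"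
    by (intro map_pmf_cong) auto
  moreover have "map_pmf (\<lambda>x. point (F (i a)) (x a)) r = map_pmf (point (F (i a))) (prob (F (i a)))"
    if "a \<in> {1..n}" for a
    unfolding couplingD(3)[OF r(1) that, symmetric] by (simp add: map_pmf_comp)
  ultimately show ?thesis
    using assms(2,3) by (simp add: same_space_iff[OF spaces spaces])
qed

text \<open>The diagonal coupling has cost zero: draw one point from the common law
  \<open>\<mu>\<close> and record its position in every space.\<close>

lemma same_space_imp_W_eq_0:
  assumes same: "\<And>a b. a \<in> {1..n} \<Longrightarrow> b \<in> {1..n} \<Longrightarrow> same_space (F (i a)) (F (i b))"
  shows "W n i = 0"
proof -
  define \<mu> where "\<mu> = map_pmf (point (F (i 1))) (prob (F (i 1)))"
  define h where "h a = inv_into (positions (F (i a))) (point (F (i a)))" for a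
  define r where "r = map_pmf (\<lambda>w. \<lambda>a\<in>{1..n}. h a w) \<mu>"
  have \<mu>: "\<mu> = map_pmf (point (F (i a))) (prob (F (i a)))" if "a \<in> {1..n}" for a
    using same[of 1 a] that by (auto simp: \<mu>_def same_space_iff[OF spaces spaces])
  have pt: "h a w \<in> positions (F (i a)) \<and> point (F (i a)) (h a w) = w"
    if "a \<in> {1..n}" "w \<in> set_pmf \<mu>" for a w
    using that \<mu>[OF that(1)] by (auto simp: h_def set_prob intro: inv_into_into f_inv_into_f)
  have r: "r \<in> couplings F n i"
    unfolding couplings_def
  proof (intro CollectI conjI ballI subsetI)
    show "y \<in> tuples n i" if "y \<in> set_pmf r" for y
      using that pt by (auto simp: r_def)
  next
    fix a assume a: "a \<in> {1..n}"
    have "map_pmf (\<lambda>x. x a) r = map_pmf (h a) \<mu>"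
      using a by (simp add: r_def map_pmf_comp)
    also have "\<dots> = map_pmf (\<lambda>s. h a (point (F (i a)) s)) (prob (F (i a)))"
      by (simp add: \<mu>[OF a] map_pmf_comp)
    also have "\<dots> = map_pmf (\<lambda>s. s) (prob (F (i a)))"
      by (intro map_pmf_cong) (auto simp: h_def set_prob inv_into_f_f[OF inj_on_point])
    finally show "map_pmf (\<lambda>x. x a) r = prob (F (i a))" by simp
  qed
  have "lp_norm l r (dst i a b) = 0" if ab: "1 \<le> a" "a < b" "b \<le> n" for a b
  proof -
    have "dst i a b x = 0" if x: "x \<in> set_pmf r" for x
    proof -
      obtain w where w: "w \<in> set_pmf \<mu>" "x = (\<lambda>a\<in>{1..n}. h a w)"
        using x by (auto simp: r_def)
      then show ?thesis
        using ab pt[of a w] pt[of b w] by (subst dist_eq_0_iff) auto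
    qed
    then show ?thesis
      using l_pos couplingD(1)[OF r] by (subst lp_norm_eq_0_iff) auto
  qed
  then have "transport_cost F d l n i r = 0"
    unfolding transport_cost_eq[OF r] by (subst pair_sum_eq_0_iff) (auto simp: lp_norm_nonneg)
  moreover have "W n i \<le> transport_cost F d l n i r"
    using r by (rule W_le_transport_cost)
  ultimately show ?thesis
    using W_nonneg[of n i] by simp
qed

section \<open>The generalized triangle inequality\<close>

text \<open>Only the \<open>m\<close> pairs that contain the last coordinate are rerouted through
  the extra space. Each pays the same additional norm, which is a single term of the cost for
  \<open>omit k i\<close>; hence the factor \<open>m\<close>.\<close>

lemma glue_couplings:
  assumes m: "m \<ge> 1" and k: "k \<in> {1..m}"
  shows "W (Suc m) i \<le> W (Suc m) (omit (Suc m) i) + real m * W (Suc m) (omit k i)"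
proof -
  let ?n = "Suc m"
  let ?u = "omit ?n i" and ?v = "omit k i"
  \<comment> \<open>Omitting label \<open>Suc m\<close> moves only the extra label, to the last
    place. Omitting \<open>k\<close>, which is at most \<open>m\<close>, puts label
    \<open>Suc m\<close> at place \<open>m\<close> and the extra label at the last place.\<close>
  have u: "?u a = i a" if "a \<in> {1..m}" for a
    using that by (simp add: omit_def)
  have un: "?u ?n = i (Suc ?n)" and vm: "?v m = i ?n" and vn: "?v ?n = i (Suc ?n)"
    using k by (simp_all add: omit_def)
  obtain p where p: "p \<in> couplings F ?n ?u" "W ?n ?u = transport_cost F d l ?n ?u p"
    by (rule optimal_coupling)
  obtain q where q: "q \<in> couplings F ?n ?v" "W ?n ?v = transport_cost F d l ?n ?v q"
    by (rule optimal_coupling)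
  have "map_pmf (\<lambda>x. x ?n) p = map_pmf (\<lambda>y. y ?n) q"
    using couplingD(3)[OF p(1), of ?n] couplingD(3)[OF q(1), of ?n] by (simp add: un vn)
  \<comment> \<open>Gluing: equality of the two marginals, read through the relator of
    \<open>pmf\<close>, supplies a joint law \<open>J\<close> of \<open>p\<close> and
    \<open>q\<close> under which the shared coordinate agrees almost surely.\<close>
  then have "rel_pmf (\<lambda>x y. x ?n = y ?n) p q"
    by (simp flip: pmf.rel_eq add: pmf.rel_map)
  then obtain J where J: "\<And>x y. (x, y) \<in> set_pmf J \<Longrightarrow> x ?n = y ?n"
    and Jp: "map_pmf fst J = p" and Jq: "map_pmf snd J = q"
    by (auto elim: rel_pmf.cases)
  have Jset: "fst z \<in> set_pmf p" "snd z \<in> set_pmf q" if "z \<in> set_pmf J" for z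
    using that by (auto simp flip: Jp Jq)
  have Jfin: "finite (set_pmf J)"
  proof (rule finite_subset)
    show "set_pmf J \<subseteq> set_pmf p \<times> set_pmf q"
      using Jset by (force simp: mem_Times_iff)
  qed (intro finite_cartesian_product couplingD(1)[OF p(1)] couplingD(1)[OF q(1)])
  have Jpos: "fst z a \<in> positions (F (?u a))" "snd z a \<in> positions (F (?v a))"
    if "z \<in> set_pmf J" "a \<in> {1..?n}" for z a
    using couplingD(4)[OF p(1) Jset(1)] couplingD(4)[OF q(1) Jset(2)] that by simp_all
  \<comment> \<open>The position in the extra space is overwritten by the position that
    \<open>q\<close> gives in the space labelled \<open>Suc m\<close>.\<close>
  define g where "g z = (fst z)(?n := snd z m)" for z :: "(nat \<Rightarrow> nat) \<times> (nat \<Rightarrow> nat)"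
  define r where "r = map_pmf g J"
  have r: "r \<in> couplings F ?n i"
    unfolding couplings_def
  proof (intro CollectI conjI ballI subsetI)
    fix y assume "y \<in> set_pmf r"
    then obtain z where z: "z \<in> set_pmf J" "y = g z"
      by (auto simp: r_def)
    have z1: "fst z \<in> tuples ?n ?u"
      using Jset(1)[OF z(1)] couplingD(2)[OF p(1)] by blast
    show "y \<in> tuples ?n i"
    proof (rule PiE_I)
      fix a assume a: "a \<in> {1..?n}"
      show "y a \<in> positions (F (i a))"
        using Jpos(1)[OF z(1) a] Jpos(2)[OF z(1), of m] a m u[of a]
        by (cases "a = ?n") (auto simp: z(2) g_def vm)
    next
      fix a assume "a \<notin> {1..?n}"
      then show "y a = undefined"
        using z1 by (auto simp: z(2) g_def dest: PiE_arb)
    qed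
  next
    fix a assume a: "a \<in> {1..?n}"
    show "map_pmf (\<lambda>x. x a) r = prob (F (i a))"
    proof (cases "a = ?n")
      case True
      have "map_pmf (\<lambda>x. x a) r = map_pmf (\<lambda>y. y m) (map_pmf snd J)"
        using True by (simp add: r_def g_def map_pmf_comp)
      then show ?thesis
        using couplingD(3)[OF q(1), of m] m True by (simp add: Jq vm)
    next
      case False
      have "map_pmf (\<lambda>x. x a) r = map_pmf (\<lambda>x. x a) (map_pmf fst J)"
        using False by (simp add: r_def g_def map_pmf_comp)
      then show ?thesis
        using couplingD(3)[OF p(1) a] u[of a] a False by (simp add: Jp)
    qed
  qed
  have old: "lp_norm l r (dst i a b) = lp_norm l p (dst ?u a b)"
    if "a \<in> {1..m}" "b \<in> {1..m}" for a b
    using that by (simp add: r_def lp_norm_map_pmf g_def u flip: Jp)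
  have new: "lp_norm l r (dst i a ?n) \<le> lp_norm l p (dst ?u a ?n) + lp_norm l q (dst ?v m ?n)"
    if a: "a \<in> {1..m}" for a
  proof -
    let ?x = "\<lambda>z. dst ?u a ?n (fst z)" and ?y = "\<lambda>z. dst ?v m ?n (snd z)"
    have nn: "0 \<le> dst i a ?n (g z)" "0 \<le> ?x z" "0 \<le> ?y z"
      and tri: "dst i a ?n (g z) \<le> ?x z + ?y z" if z: "z \<in> set_pmf J" for z
    proof -
      have 1: "fst z a \<in> positions (F (i a))"
        using Jpos(1)[OF z, of a] a u[OF a] by auto
      have 2: "snd z m \<in> positions (F (i ?n))"
        using Jpos(2)[OF z, of m] m by (simp add: vm)
      have 3: "fst z ?n \<in> positions (F (i (Suc ?n)))"
        using Jpos(1)[OF z, of ?n] by (simp add: un)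
      have 4: "snd z ?n = fst z ?n"
        using J[of "fst z" "snd z"] z by simp
      have x: "?x z = dist_at F d (i a) (i (Suc ?n)) (fst z a) (fst z ?n)"
        by (simp add: un u[OF a])
      \<comment> \<open>Symmetry and agreement on the shared coordinate turn this into the second
        leg of a triangle through the point \<open>fst z ?n\<close>.\<close>
      have y: "?y z = dist_at F d (i (Suc ?n)) (i ?n) (fst z ?n) (snd z m)"
        using 2 3 dist_sym by (simp add: vm vn 4)
      have xy: "dst i a ?n (g z) = dist_at F d (i a) (i ?n) (fst z a) (snd z m)"
        using a by (simp add: g_def)
      show "0 \<le> dst i a ?n (g z)" "0 \<le> ?x z" "0 \<le> ?y z" "dst i a ?n (g z) \<le> ?x z + ?y z"
        unfolding x y xy using 1 2 3 by (auto intro: dist_nonneg dist_triangle)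
    qed
    have "lp_norm l r (dst i a ?n) = lp_norm l J (\<lambda>z. dst i a ?n (g z))"
      by (simp only: r_def lp_norm_map_pmf)
    also have "\<dots> \<le> lp_norm l J (\<lambda>z. ?x z + ?y z)"
      using nn tri Jfin by (intro lp_norm_mono)
    also have "\<dots> \<le> lp_norm l J ?x + lp_norm l J ?y"
      using nn Jfin l_pos by (intro lp_norm_add)
    also have "\<dots> = lp_norm l p (dst ?u a ?n) + lp_norm l q (dst ?v m ?n)"
      by (simp only: lp_norm_map_pmf flip: Jp Jq)
    finally show ?thesis .
  qed
  have "W ?n i \<le> transport_cost F d l ?n i r"
    using r by (rule W_le_transport_cost)
  also have "\<dots> = pair_sum m (\<lambda>a b. lp_norm l p (dst ?u a b)) + (\<Sum>a\<in>{1..m}. lp_norm l r (dst i a ?n))"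
    unfolding transport_cost_eq[OF r] pair_sum_Suc
    by (intro arg_cong2[where f = "(+)"] pair_sum_cong old refl) auto
  also have "\<dots> \<le> pair_sum m (\<lambda>a b. lp_norm l p (dst ?u a b))
      + (\<Sum>a\<in>{1..m}. lp_norm l p (dst ?u a ?n) + lp_norm l q (dst ?v m ?n))"
    by (intro add_left_mono sum_mono new)
  also have "\<dots> = W ?n ?u + real m * lp_norm l q (dst ?v m ?n)"
    by (simp add: p(2) transport_cost_eq[OF p(1)] pair_sum_Suc sum.distrib)
  also have "lp_norm l q (dst ?v m ?n) \<le> W ?n ?v"
    unfolding q(2) transport_cost_eq[OF q(1)]
    using m by (intro member_le_pair_sum lp_norm_nonneg) auto
  finally show ?thesis by (simp add: mult_left_mono)
qed

lemma W_le_sum_omit: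
  assumes "n \<ge> 2"
  shows "W n i \<le> (\<Sum>r\<in>{1..n}. W n (omit r i))"
proof -
  obtain m where n: "n = Suc m" and m: "m \<ge> 1"
    using assms by (cases n) auto
  let ?w = "\<lambda>r. W n (omit r i)"
  \<comment> \<open>The cheapest omission is chosen, so that \<open>m\<close> times its value is at
    most the sum over \<open>{1..m}\<close>. The set is nonempty because \<open>n\<close> is at
    least 2.\<close>
  have "Min (?w ` {1..m}) \<in> ?w ` {1..m}"
    using m by (intro Min_in) auto
  then obtain k where k: "k \<in> {1..m}" "Min (?w ` {1..m}) = ?w k"
    by (elim imageE) (auto intro: that)
  have "real m * ?w k = (\<Sum>r\<in>{1..m}. ?w k)" by simp
  also have "\<dots> \<le> (\<Sum>r\<in>{1..m}. ?w r)"
    by (intro sum_mono) (simp flip: k(2))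
  finally show ?thesis
    using glue_couplings[OF m k(1), of i] by (simp add: n)
qed

end

theorem theorem3:
  fixes n :: nat
  assumes "n \<ge> 2"
  shows "\<exists>C::real. C \<ge> 1 \<and>
    (\<forall>(l::nat) (F :: 'i \<Rightarrow> 'w finite_space) (d :: 'i \<Rightarrow> 'i \<Rightarrow> 'w \<Rightarrow> 'w \<Rightarrow> real).
       l \<ge> 1 \<longrightarrow> (\<forall>i. finite_prob_space (F i)) \<longrightarrow> metric_family F d \<longrightarrow>
       n_metric F n C (pairwise_mmot F d l n))"
proof (rule exI[of _ 1], intro conjI allI impI)
  fix l :: nat and F :: "'i \<Rightarrow> 'w finite_space" and d :: "'i \<Rightarrow> 'i \<Rightarrow> 'w \<Rightarrow> 'w \<Rightarrow> real"
  assume "l \<ge> 1" "\<forall>i. finite_prob_space (F i)" "metric_family F d"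
  then interpret metric_spaces F d l
    by unfold_locales auto
  show "n_metric F n 1 (pairwise_mmot F d l n)"
    unfolding n_metric_def mult_1
  proof (intro allI impI conjI iffI ballI)
    fix i :: "nat \<Rightarrow> 'i" and \<sigma> assume \<sigma>: "\<sigma> permutes {1..n}"
    show "0 \<le> W n i" by (rule W_nonneg)
    show "same_space (F (i a)) (F (i b))" if "W n i = 0" "a \<in> {1..n}" "b \<in> {1..n}" for a b
      using that by (rule W_eq_0_imp_same_space)
    show "W n i = 0" if "\<forall>a\<in>{1..n}. \<forall>b\<in>{1..n}. same_space (F (i a)) (F (i b))"
      using that by (intro same_space_imp_W_eq_0) blast
    show "W n i = W n (i \<circ> \<sigma>)"
      using W_permute[OF \<sigma>] by simp
    show "W n i \<le> (\<Sum>r\<in>{1..n}. W n (omit r i))"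
      using assms by (rule W_le_sum_omit)
  qed
qed simp

end
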